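(* The lattice ${\bf E}_{\mathbb{B}}$ of equational classes of Boolean functions (ordered by inclusion) has no co-atoms, i.e. there is no equational class $\mathcal{M}\subsetneq\Omega$ such that the only equational classes containing $\mathcal{M}$ are $\mathcal{M}$ and $\Omega$.
   Context: $\mathbb{B}=\{0,1\}$; $\Omega=\bigcup_{n\ge1}\mathbb{B}^{\mathbb{B}^n}$ is the set of all Boolean functions. For an $m$-ary $g$ and $n$-ary $f$, $g\preceq_{\bf V}f$ means $g=f(p_1,\dots,p_n)$ for some $m$-ary projections $p_i$. An equational class is a subset of $\Omega$ closed under this (downward) relation; ${\bf E}_{\mathbb{B}}$ is the set of all equational classes, a complete lattice under union and intersection with top element $\Omega$. *)

theory Defs
  imports "HOL-Library.FuncSet"
begin

text \<open>The elements of \<open>\<bool>\<^sup>n\<close> are the lists of length \<open>n\<close>.\<close>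

definition cube :: "nat \<Rightarrow> bool list set" where
  "cube n = {x. length x = n}"

text \<open>
  A Boolean function is tagged with its arity: two functions of different arities are always
  distinct, whereas the underlying HOL functions need not be.
  The restriction to extensional functions makes equality pointwise equality on \<open>cube n\<close>.
\<close>

type_synonym boolfun = "nat \<times> (bool list \<Rightarrow> bool)"

definition Omega :: "boolfun set" where
  "Omega = (SIGMA n : {1..}. cube n \<rightarrow>\<^sub>E UNIV)"

definition projections :: "nat \<Rightarrow> (bool list \<Rightarrow> bool) set" where
  "projections m = {\<lambda>x\<in>cube m. x ! i | i. i < m}"

definition minor :: "boolfun \<Rightarrow> boolfun \<Rightarrow> bool"  (infix "\<preceq>\<^sub>V" 50) where
  "g \<preceq>\<^sub>V f \<longleftrightarrow>
     (\<exists>ps. length ps = fst f \<and> set ps \<subseteq> projections (fst g) \<and>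
           snd g = (\<lambda>x\<in>cube (fst g). snd f (map (\<lambda>p. p x) ps)))"

definition equational_class :: "boolfun set \<Rightarrow> bool" where
  "equational_class M \<longleftrightarrow> M \<subseteq> Omega \<and> (\<forall>f\<in>M. \<forall>g\<in>Omega. g \<preceq>\<^sub>V f \<longrightarrow> g \<in> M)"

definition E_B :: "boolfun set set" where
  "E_B = {M. equational_class M}"

definition coatom :: "'a::order set \<Rightarrow> 'a \<Rightarrow> 'a \<Rightarrow> bool" where
  "coatom L t a \<longleftrightarrow> a \<in> L \<and> a < t \<and> (\<forall>b\<in>L. a \<le> b \<longrightarrow> b = a \<or> b = t)"
  \<comment> \<open>\<open>t\<close> is meant to be the greatest element of \<open>L\<close>\<close>

lemma Omega_greatest: "Omega \<in> E_B" "M \<in> E_B \<Longrightarrow> M \<subseteq> Omega"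
  by (auto simp: E_B_def equational_class_def)

lemma E_B_Union: "\<M> \<subseteq> E_B \<Longrightarrow> \<Union>\<M> \<in> E_B"
  unfolding E_B_def equational_class_def by blast

lemma E_B_Inter: "\<M> \<subseteq> E_B \<Longrightarrow> \<M> \<noteq> {} \<Longrightarrow> \<Inter>\<M> \<in> E_B"
  unfolding E_B_def equational_class_def by blast

end

theory Submission
  imports Defs
begin

text \<open>
  If \<open>M\<close> were a co-atom and \<open>f\<close> an \<open>n\<close>-ary function outside \<open>M\<close>, then every Boolean function
  outside \<open>M\<close> would be a minor of \<open>f\<close>, and so depend on at most \<open>n\<close> variables. But adding to \<open>f\<close>
  the sum modulo 2 of \<open>2 n\<close> new variables gives a function that depends on all of these new
  variables, and that lies outside \<open>M\<close> because it yields \<open>f\<close> when the new variables are identified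
  with the first variable of \<open>f\<close>.
\<close>

text \<open>A projection on the cube is given by its index, so a minor amounts to a list
  \<open>is\<close> whose entry at position k names the variable substituted for the k-th argument
  of \<open>f\<close>. The later proofs work with such lists of indices only.\<close>

lemma minor_iff_indices:
  "g \<preceq>\<^sub>V f \<longleftrightarrow>
     (\<exists>is. length is = fst f \<and> set is \<subseteq> {..<fst g} \<and>
           snd g = (\<lambda>x\<in>cube (fst g). snd f (map ((!) x) is)))"
    (is "_ \<longleftrightarrow> ?R")
proof
  assume "g \<preceq>\<^sub>V f"
  then obtain ps where len: "length ps = fst f" and ps: "set ps \<subseteq> projections (fst g)"
    and g: "snd g = (\<lambda>x\<in>cube (fst g). snd f (map (\<lambda>p. p x) ps))"
    unfolding minor_def by blast
  from ps have "\<forall>p\<in>set ps. \<exists>i<fst g. p = (\<lambda>x\<in>cube (fst g). x ! i)"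
    unfolding projections_def by blast
  then obtain j where j: "\<And>p. p \<in> set ps \<Longrightarrow> j p < fst g \<and> p = (\<lambda>x\<in>cube (fst g). x ! j p)"
    by metis
  have "map (\<lambda>p. p x) ps = map ((!) x) (map j ps)" if "x \<in> cube (fst g)" for x
  proof -
    have "p x = x ! j p" if "p \<in> set ps" for p
      using j[OF that] \<open>x \<in> cube (fst g)\<close> by (metis restrict_apply')
    then show ?thesis by simp
  qed
  then have "snd g = (\<lambda>x\<in>cube (fst g). snd f (map ((!) x) (map j ps)))"
    unfolding g by (intro restrict_ext arg_cong[where f = "snd f"])
  moreover have "set (map j ps) \<subseteq> {..<fst g}" using j by auto
  ultimately show ?R using len by (metis length_map)
next
  assume ?R
  then obtain js where "length js = fst f" "set js \<subseteq> {..<fst g}"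
    and g: "snd g = (\<lambda>x\<in>cube (fst g). snd f (map ((!) x) js))"
    by blast
  let ?ps = "map (\<lambda>i. \<lambda>x\<in>cube (fst g). x ! i) js"
  have "snd g = (\<lambda>x\<in>cube (fst g). snd f (map (\<lambda>p. p x) ?ps))"
    unfolding g by (intro restrict_ext) (simp add: comp_def)
  moreover have "set ?ps \<subseteq> projections (fst g)"
    using \<open>set js \<subseteq> _\<close> by (auto simp: projections_def)
  ultimately show "g \<preceq>\<^sub>V f"
    using \<open>length js = _\<close> unfolding minor_def by (metis length_map)
qed

lemma minor_refl:
  assumes "f \<in> Omega"
  shows "f \<preceq>\<^sub>V f"
proof -
  have "snd f = (\<lambda>x\<in>cube (fst f). snd f (map ((!) x) [0..<fst f]))"
  proof
    fix x
    show "snd f x = (\<lambda>x\<in>cube (fst f). snd f (map ((!) x) [0..<fst f])) x"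
    proof (cases "x \<in> cube (fst f)")
      case True
      then have "map ((!) x) [0..<fst f] = x" using map_nth[of x] by (simp add: cube_def)
      with True show ?thesis by simp
    next
      \<comment> \<open>Off the cube both sides are \<open>undefined\<close>, because functions in
        \<open>Omega\<close> are extensional.\<close>
      case False
      with assms show ?thesis by (auto simp: Omega_def)
    qed
  qed
  then show ?thesis
    unfolding minor_iff_indices by (intro exI[of _ "[0..<fst f]"]) auto
qed

lemma minor_trans:
  assumes "h \<preceq>\<^sub>V g" "g \<preceq>\<^sub>V f"
  shows "h \<preceq>\<^sub>V f"
proof -
  obtain js where js: "length js = fst g" "set js \<subseteq> {..<fst h}"
    and h: "snd h = (\<lambda>x\<in>cube (fst h). snd g (map ((!) x) js))"
    using assms(1) unfolding minor_iff_indices by blast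
  obtain ks where ks: "length ks = fst f" "set ks \<subseteq> {..<fst g}"
    and g: "snd g = (\<lambda>x\<in>cube (fst g). snd f (map ((!) x) ks))"
    using assms(2) unfolding minor_iff_indices by blast
  \<comment> \<open>Substitutions compose: argument k of \<open>f\<close> reads coordinate
    \<open>js ! (ks ! k)\<close> of \<open>x\<close>. Any list \<open>x\<close> is allowed, since
    the length of \<open>js\<close> alone puts \<open>map ((!) x) js\<close> in the domain of
    \<open>g\<close>.\<close>
  have "snd g (map ((!) x) js) = snd f (map ((!) x) (map ((!) js) ks))" for x
  proof -
    have "map ((!) (map ((!) x) js)) ks = map ((!) x) (map ((!) js) ks)"
      using js ks by auto
    then have "snd f (map ((!) (map ((!) x) js)) ks) = snd f (map ((!) x) (map ((!) js) ks))"
      by (rule arg_cong)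
    then show ?thesis using js(1) unfolding g by (simp add: cube_def)
  qed
  then have "snd h = (\<lambda>x\<in>cube (fst h). snd f (map ((!) x) (map ((!) js) ks)))"
    unfolding h by simp
  moreover have "set (map ((!) js) ks) \<subseteq> {..<fst h}"
    using js ks by (auto simp: subset_iff)
  ultimately show ?thesis
    unfolding minor_iff_indices using ks(1) by (intro exI[of _ "map ((!) js) ks"]) auto
qed

lemma equational_class_minors: "equational_class {g \<in> Omega. g \<preceq>\<^sub>V f}"
  unfolding equational_class_def using minor_trans by blast

text \<open>Flipping one bit changes the number of \<open>True\<close> entries by exactly
  one.\<close>

lemma odd_count_list_update:
  assumes "i < length xs"
  shows "odd (count_list (xs[i := \<not> xs ! i]) True) \<longleftrightarrow> even (count_list xs True)"
  using assms by (induction xs arbitrary: i) (auto split: nat.split)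

text \<open>On \<open>bool\<close>, \<open>\<noteq>\<close> is addition modulo 2. The number 2 n of
  new variables is even, so that they cancel when identified, and exceeds n, so that n indices
  cannot cover them.\<close>

definition add_parity :: "boolfun \<Rightarrow> boolfun" where
  "add_parity f = (3 * fst f,
     \<lambda>z\<in>cube (3 * fst f). snd f (take (fst f) z) \<noteq> odd (count_list (drop (fst f) z) True))"

lemma add_parity_in_Omega: "f \<in> Omega \<Longrightarrow> add_parity f \<in> Omega"
  by (auto simp: add_parity_def Omega_def)

lemma minor_add_parity:
  assumes "f \<in> Omega"
  shows "f \<preceq>\<^sub>V add_parity f"
proof -
  define n where "n = fst f"
  \<comment> \<open>All new variables are identified with variable 0, which exists as n is positive;
    2 n equal bits have even parity.\<close>
  define js where "js = [0..<n] @ replicate (2 * n) 0"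
  have "n \<ge> 1" using assms by (auto simp: Omega_def n_def)
  have count: "count_list (replicate k b) True = (if b then k else 0)" for k b
    by (induction k) auto
  have "snd f x = (\<lambda>x\<in>cube n. snd (add_parity f) (map ((!) x) js)) x" for x
  proof (cases "x \<in> cube n")
    case True
    then have "length x = n" by (simp add: cube_def)
    then have "map ((!) x) js = x @ replicate (2 * n) (x ! 0)"
      using map_nth[of x] by (simp add: js_def)
    with True \<open>length x = n\<close> show ?thesis
      by (simp add: add_parity_def n_def[symmetric] cube_def count del: map_eq_conv length_map)
  next
    case False
    with assms show ?thesis by (auto simp: Omega_def n_def)
  qed
  moreover have "length js = fst (add_parity f)" "set js \<subseteq> {..<n}"
    using \<open>n \<ge> 1\<close> by (auto simp: js_def add_parity_def n_def)
  ultimately show ?thesis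
    unfolding minor_iff_indices n_def by (intro exI[of _ js]) auto
qed

lemma not_add_parity_minor:
  assumes "f \<in> Omega"
  shows "\<not> add_parity f \<preceq>\<^sub>V f"
proof
  define n where "n = fst f"
  have "n \<ge> 1" using assms by (auto simp: Omega_def n_def)
  assume "add_parity f \<preceq>\<^sub>V f"
  then obtain js where js: "length js = n"
    and eq: "snd (add_parity f) = (\<lambda>x\<in>cube (3 * n). snd f (map ((!) x) js))"
    unfolding minor_iff_indices by (auto simp: add_parity_def n_def)
  \<comment> \<open>Pigeonhole: at most n coordinates are read through \<open>js\<close>, fewer than
    the 2 n new ones.\<close>
  have "card (set js) < card {n..<3 * n}"
    using card_length[of js] js \<open>n \<ge> 1\<close> by simp
  then have "\<not> {n..<3 * n} \<subseteq> set js"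
    by (meson card_mono finite_set linorder_not_less)
  then obtain i where i: "n \<le> i" "i < 3 * n" "i \<notin> set js"
    by (meson atLeastLessThan_iff subsetI)
  \<comment> \<open>The points \<open>x\<close> and \<open>y\<close> differ only in the unread new
    coordinate \<open>i\<close>: the minor of \<open>f\<close> agrees on them, but the parity does
    not.\<close>
  define x where "x = replicate (3 * n) False"
  define y where "y = x[i := \<not> x ! i]"
  have len: "length x = 3 * n" "length y = 3 * n" by (simp_all add: x_def y_def)
  have "map ((!) y) js = map ((!) x) js"
    using i(3) by (intro map_cong refl) (metis nth_list_update_neq y_def)
  then have "snd (add_parity f) y = snd (add_parity f) x"
    unfolding eq by (simp add: cube_def len del: map_eq_conv)
  moreover have "take n y = take n x" using i by (simp add: y_def)
  \<comment> \<open>Coordinate \<open>i\<close> has position \<open>i - n\<close> among the new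
    variables.\<close>
  moreover have "drop n y = (drop n x)[i - n := \<not> drop n x ! (i - n)]"
    using i len by (simp add: y_def drop_update_swap)
  then have "odd (count_list (drop n y) True) \<longleftrightarrow> even (count_list (drop n x) True)"
    using i len odd_count_list_update[of "i - n" "drop n x"] by simp
  ultimately show False
    using len by (auto simp: add_parity_def n_def[symmetric] cube_def)
qed

theorem theorem7:
  shows "\<not> (\<exists>M. coatom E_B Omega M)"
proof
  assume "\<exists>M. coatom E_B Omega M"
  then obtain M where M: "equational_class M" "M \<subset> Omega"
    and max: "\<And>N. equational_class N \<Longrightarrow> M \<subseteq> N \<Longrightarrow> N = M \<or> N = Omega"
    unfolding coatom_def E_B_def by auto
  then obtain f where f: "f \<in> Omega" "f \<notin> M" by blast
  \<comment> \<open>The least equational class containing \<open>M\<close> and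
    \<open>f\<close>.\<close>
  let ?N = "M \<union> {g \<in> Omega. g \<preceq>\<^sub>V f}"
  have "equational_class ?N"
    using M(1) equational_class_minors[of f] unfolding equational_class_def by blast
  moreover have "f \<in> ?N" using f minor_refl by blast
  ultimately have "?N = Omega" using max[of ?N] f by blast
  \<comment> \<open>Otherwise downward closure of \<open>M\<close> would put \<open>f\<close> in
    \<open>M\<close>.\<close>
  moreover have "add_parity f \<notin> M"
    using M(1) f minor_add_parity unfolding equational_class_def by blast
  ultimately have "add_parity f \<preceq>\<^sub>V f"
    using add_parity_in_Omega[OF f(1)] by blast
  with not_add_parity_minor[OF f(1)] show False by contradiction
qed

end
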